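(* Let $X$ be a countably infinite set. For any ideals $I$ and $J$ on $X$, $\mathcal C_I^{(1)}\subseteq\mathcal C_J^{(1)}$ implies $I\subseteq J$.
   Context: An ideal on $X$ means here a family $I$ of subsets of $X$ that is closed under subsets and finite unions, contains all finite subsets of $X$, contains at least one infinite set, and does not contain all subsets of $X$. For an ideal $I$, $\mathcal C_I$ denotes the set of all finitary operations $f:X^n\to X$ ($n\ge1$) such that $f[A^n]\in I$ for all $A\in I$, and $\mathcal C_I^{(1)}$ denotes the set of unary functions $X\to X$ belonging to $\mathcal C_I$. *)

theory Defs
  imports Main "HOL-Library.FuncSet" "HOL-Library.Countable_Set"
begin

definition ideal_on :: "'a set \<Rightarrow> 'a set set \<Rightarrow> bool" where
  "ideal_on X I \<longleftrightarrow>
     I \<subseteq> Pow X \<and>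
     (\<forall>A\<in>I. \<forall>B. B \<subseteq> A \<longrightarrow> B \<in> I) \<and>
     (\<forall>A\<in>I. \<forall>B\<in>I. A \<union> B \<in> I) \<and>
     (\<forall>A. A \<subseteq> X \<and> finite A \<longrightarrow> A \<in> I) \<and>
     (\<exists>A\<in>I. infinite A) \<and>
     I \<noteq> Pow X"

text \<open>
  Elements of the power \<open>A^n\<close> are functions on \<open>{..<n}\<close>, extended by \<open>undefined\<close>. Operations
  are likewise extensional outside \<open>X^n\<close>, so that each operation on \<open>X\<close> has exactly one
  representative.
\<close>

definition tuples :: "'a set \<Rightarrow> nat \<Rightarrow> (nat \<Rightarrow> 'a) set" where
  "tuples A n = ({..<n} \<rightarrow>\<^sub>E A)"

text \<open>An operation is paired with its arity.\<close>

definition finitary_operations :: "'a set \<Rightarrow> (nat \<times> ((nat \<Rightarrow> 'a) \<Rightarrow> 'a)) set" where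
  "finitary_operations X = {(n, f). n \<ge> 1 \<and> f \<in> tuples X n \<rightarrow>\<^sub>E X}"

definition ideal_clone :: "'a set \<Rightarrow> 'a set set \<Rightarrow> (nat \<times> ((nat \<Rightarrow> 'a) \<Rightarrow> 'a)) set" where
  "ideal_clone X I =
     {(n, f). (n, f) \<in> finitary_operations X \<and> (\<forall>A\<in>I. f ` tuples A n \<in> I)}"

text \<open>A function \<open>X \<rightarrow> X\<close> viewed as an operation \<open>X^1 \<rightarrow> X\<close>.\<close>

definition unary_operation :: "'a set \<Rightarrow> ('a \<Rightarrow> 'a) \<Rightarrow> (nat \<Rightarrow> 'a) \<Rightarrow> 'a" where
  "unary_operation X g = (\<lambda>x\<in>tuples X 1. g (x 0))"

definition unary_ideal_clone :: "'a set \<Rightarrow> 'a set set \<Rightarrow> ('a \<Rightarrow> 'a) set" where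
  "unary_ideal_clone X I =
     {g \<in> X \<rightarrow>\<^sub>E X. (1, unary_operation X g) \<in> ideal_clone X I}"

end

theory Submission
  imports Defs
begin

text \<open>
  A map whose whole range lies in some \<open>A \<in> I\<close> preserves \<open>I\<close> for trivial reasons, since ideals
  are closed under subsets. Suppose \<open>A \<in> I\<close> but \<open>A \<notin> J\<close>. Since \<open>J\<close> contains the finite sets,
  \<open>A\<close> is nonempty. Since \<open>J\<close> also contains an infinite set \<open>B\<close>, and \<open>A\<close> is
  countable, some map of \<open>X\<close> into \<open>A\<close> sends \<open>B\<close> onto \<open>A\<close>. It preserves \<open>I\<close> but not \<open>J\<close>.
\<close>

lemma unary_operation_image:
  assumes "S \<subseteq> X"
  shows "unary_operation X g ` tuples S 1 = g ` S"
proof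
  show "unary_operation X g ` tuples S 1 \<subseteq> g ` S"
    using assms by (auto simp: unary_operation_def tuples_def PiE_iff)
  show "g ` S \<subseteq> unary_operation X g ` tuples S 1"
  proof
    fix y assume "y \<in> g ` S"
    then obtain s where "s \<in> S" "y = g s" by blast
    then have "(\<lambda>i\<in>{..<1}. s) \<in> tuples S 1" "y = unary_operation X g (\<lambda>i\<in>{..<1}. s)"
      using assms by (auto simp: unary_operation_def tuples_def)
    then show "y \<in> unary_operation X g ` tuples S 1" by blast
  qed
qed

lemma unary_ideal_clone_iff:
  assumes "I \<subseteq> Pow X"
  shows "g \<in> unary_ideal_clone X I \<longleftrightarrow> g \<in> X \<rightarrow>\<^sub>E X \<and> (\<forall>S\<in>I. g ` S \<in> I)"
proof -
  have "(1, unary_operation X g) \<in> finitary_operations X" if "g \<in> X \<rightarrow>\<^sub>E X"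
    using that by (auto simp: finitary_operations_def unary_operation_def tuples_def PiE_iff)
  moreover have "unary_operation X g ` tuples S 1 = g ` S" if "S \<in> I" for S
    using that assms by (intro unary_operation_image) blast
  ultimately show ?thesis
    unfolding unary_ideal_clone_def ideal_clone_def by auto
qed

lemma map_into_countable_onto_from_infinite:
  assumes "countable A" "A \<noteq> {}" "countable B" "infinite B"
  obtains h where "range h \<subseteq> A" "h ` B = A"
proof
  \<comment> \<open>Both properties use that \<open>from_nat_into A\<close> takes values in \<open>A\<close> on all of \<open>nat\<close>, with
    repetitions if \<open>A\<close> is finite.\<close>
  let ?h = "from_nat_into A \<circ> to_nat_on B"
  show "range ?h \<subseteq> A"
    using assms(2) by (auto intro: from_nat_into)
  have "to_nat_on B ` B = UNIV"
    using to_nat_on_infinite[OF assms(3,4)] by (simp add: bij_betw_def)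
  then show "?h ` B = A"
    using range_from_nat_into[OF assms(2,1)] by (simp only: image_comp[symmetric])
qed

theorem proposition2:
  fixes X :: "'a set" and I J :: "'a set set"
  assumes "countable X" and "infinite X"
    and "ideal_on X I" and "ideal_on X J"
    and "unary_ideal_clone X I \<subseteq> unary_ideal_clone X J"
  shows "I \<subseteq> J"
proof (rule subsetI, rule ccontr)
  fix A assume "A \<in> I" "A \<notin> J"
  have IX: "I \<subseteq> Pow X" and down: "\<And>S T. S \<in> I \<Longrightarrow> T \<subseteq> S \<Longrightarrow> T \<in> I"
    using assms(3) by (simp_all add: ideal_on_def)
  have JX: "J \<subseteq> Pow X" and finJ: "\<And>S. S \<subseteq> X \<Longrightarrow> finite S \<Longrightarrow> S \<in> J"
    using assms(4) by (simp_all add: ideal_on_def)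
  obtain B where B: "B \<in> J" "infinite B"
    using assms(4) by (auto simp only: ideal_on_def)
  have "A \<subseteq> X" "B \<subseteq> X" using \<open>A \<in> I\<close> IX B JX by blast+
  have "A \<noteq> {}" using \<open>A \<notin> J\<close> finJ[of "{}"] by auto
  obtain h where h: "range h \<subseteq> A" "h ` B = A"
    by (rule map_into_countable_onto_from_infinite[OF countable_subset[OF \<open>A \<subseteq> X\<close> assms(1)]
      \<open>A \<noteq> {}\<close> countable_subset[OF \<open>B \<subseteq> X\<close> assms(1)] \<open>infinite B\<close>])
  let ?g = "restrict h X"
  have "?g \<in> X \<rightarrow>\<^sub>E X" using h(1) \<open>A \<subseteq> X\<close> by auto
  moreover have "?g ` S \<in> I" if "S \<in> I" for S
  proof (rule down[OF \<open>A \<in> I\<close>])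
    show "?g ` S \<subseteq> A" using that IX h(1) by auto
  qed
  ultimately have "?g \<in> unary_ideal_clone X J"
    using unary_ideal_clone_iff[OF IX] assms(5) by blast
  then have "?g ` B \<in> J" using unary_ideal_clone_iff[OF JX] B by blast
  moreover have "?g ` B = h ` B"
    using \<open>B \<subseteq> X\<close> by (intro image_cong) auto
  ultimately show False using h(2) \<open>A \<notin> J\<close> by simp
qed

end
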